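(* The assignment $(w,\lambda,\mu)\mapsto(w',\lambda',\mu')$ defined by $$w'=w+\varepsilon(w),\qquad \lambda'=(-1)^{w_1+w_4+\cdots+w_{3\tau-2}+\tau}\lambda,\qquad \mu'=\mu$$ (where $w\in\mathbb Z^{3\tau}$) always produces a normal loop word $w'$, and it is a bijection from the set of non-degenerate band data to the set of non-degenerate loop data. Its inverse is $(w',\lambda',\mu')\mapsto(w,\lambda,\mu)$ with $w=w'-\varepsilon'(w')$, $\lambda=(-1)^{w_1+w_4+\cdots+w_{3\tau-2}+\tau}\lambda'$, $\mu=\mu'$.
   Context: All words lie in $\mathbb Z^{3\tau}$ for some $\tau\ge1$, with indices cyclic in $\mathbb Z/3\tau$. A word is periodic if it is the concatenation of $N\ge2$ copies of a shorter word (of length divisible by $3$). A band datum $(w,\lambda,\mu)$ consists of a non-periodic word $w$, $\lambda\in\mathbb C^*$ and $\mu\in\mathbb Z_{\ge1}$; it is degenerate if $w=(0,0,0)$ and $\lambda=1$. A loop datum $(w',\lambda',\mu')$ consists of a non-periodic normal word $w'$, $\lambda'\in\mathbb C^*$, $\mu'\in\mathbb Z_{\ge1}$; it is degenerate if $w'=(2,2,2)$ and $\lambda'=-1$. Non-degenerate means not degenerate. Normal: (subwords being cyclically consecutive entries) (i) any subword $(a,1,b)$ satisfies $a,b\le0$; (ii) any subword $(a,0,b)$ satisfies ($a\le-1$, $b\ge1$) or ($a\ge1$, $b\le-1$) or ($a,b\ge1$); (iii) there is no subword $(0,-1,\dots,-1,0)$; (iv) $w'\neq(-1,\dots,-1)$.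 Sign word $\delta(w)\in\{0,1\}^{3\tau}$: $\delta_j=0$ if $w_j<0$, or if $w_j=0$ and at least one of the (cyclically) first non-zero entries adjacent, on either side, to the maximal string of $0$s containing $w_j$ exists and is negative; $\delta_j=1$ otherwise. Correction word: $\varepsilon(w)_j=-1+\delta_{j-1}+\delta_j+\delta_{j+1}$. For a normal loop word $w'$: $\delta'_j=0$ if $w'_j\le0$ and $\delta'_j=1$ if $w'_j>0$; $\varepsilon'(w')_j=-1+\delta'_{j-1}+\delta'_j+\delta'_{j+1}$. *)

theory Defs
  imports Complex_Main
begin

definition words :: "int list set" where
  "words = {w. \<exists>\<tau>\<ge>1. length w = 3 * \<tau>}"

text \<open>Entries are indexed cyclically from 0: the entry \<open>w\<^sub>j\<close> of the usual 1-based
  notation is \<open>cyc w (j - 1)\<close>.\<close>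

definition cyc :: "int list \<Rightarrow> int \<Rightarrow> int" where
  "cyc w i = w ! nat (i mod int (length w))"

definition periodic :: "int list \<Rightarrow> bool" where
  "periodic w \<longleftrightarrow> (\<exists>N u. N \<ge> 2 \<and> u \<in> words \<and> w = concat (replicate N u))"

text \<open>In (iii), \<open>a\<close> and \<open>b\<close> are the positions of the two zeros; \<open>a + 1 < b\<close> says that there
  is at least one \<open>-1\<close> between them. Adjacent zeros are excluded by (ii).\<close>

definition normal :: "int list \<Rightarrow> bool" where
  "normal w \<longleftrightarrow>
     (\<forall>i. cyc w i = 1 \<longrightarrow> cyc w (i - 1) \<le> 0 \<and> cyc w (i + 1) \<le> 0) \<and>
     (\<forall>i. cyc w i = 0 \<longrightarrow>
        (cyc w (i - 1) \<le> -1 \<and> cyc w (i + 1) \<ge> 1) \<or>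
        (cyc w (i - 1) \<ge> 1 \<and> cyc w (i + 1) \<le> -1) \<or>
        (cyc w (i - 1) \<ge> 1 \<and> cyc w (i + 1) \<ge> 1)) \<and>
     (\<nexists>a b. a + 1 < b \<and> cyc w a = 0 \<and> cyc w b = 0 \<and> (\<forall>m\<in>{a<..<b}. cyc w m = -1)) \<and>
     w \<noteq> replicate (length w) (-1)"

text \<open>In a word with a non-zero entry, the maximal string of zeros containing a zero entry
  at \<open>i\<close> is \<open>{a<..<b}\<close> for positions \<open>a < i < b\<close> of non-zero entries; in the word
  \<open>(0,\<dots>,0)\<close> there are no such positions and the sign is 1.\<close>

definition next_to_negative :: "int list \<Rightarrow> int \<Rightarrow> bool" where
  "next_to_negative w i \<longleftrightarrow>
     (\<exists>a b. a < i \<and> i < b \<and> (\<forall>m\<in>{a<..<b}. cyc w m = 0) \<and>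
        cyc w a \<noteq> 0 \<and> cyc w b \<noteq> 0 \<and> (cyc w a < 0 \<or> cyc w b < 0))"

definition sign_word :: "int list \<Rightarrow> int list" where
  "sign_word w =
     map (\<lambda>i. if cyc w (int i) < 0 \<or> (cyc w (int i) = 0 \<and> next_to_negative w (int i))
              then 0 else 1) [0..<length w]"

definition loop_sign_word :: "int list \<Rightarrow> int list" where
  "loop_sign_word w' = map (\<lambda>x. if x \<le> 0 then 0 else 1) w'"

definition correction_of_signs :: "int list \<Rightarrow> int list" where
  "correction_of_signs d =
     map (\<lambda>i. -1 + cyc d (int i - 1) + cyc d (int i) + cyc d (int i + 1)) [0..<length d]"

definition correction :: "int list \<Rightarrow> int list" where
  "correction w = correction_of_signs (sign_word w)"

definition loop_correction :: "int list \<Rightarrow> int list" where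
  "loop_correction w' = correction_of_signs (loop_sign_word w')"

definition to_loop_word :: "int list \<Rightarrow> int list" where
  "to_loop_word w = map2 (+) w (correction w)"

definition to_band_word :: "int list \<Rightarrow> int list" where
  "to_band_word w' = map2 (-) w' (loop_correction w')"

text \<open>The sign \<open>(-1)\<^bsup>w\<^sub>1 + w\<^sub>4 + \<dots> + w\<^bsub>3\<tau>-2\<^esub> + \<tau>\<^esup>\<close> (in 1-based indexing).\<close>

definition parameter_sign :: "int list \<Rightarrow> complex" where
  "parameter_sign w =
     (let \<tau> = length w div 3 in (-1) powi ((\<Sum>k<\<tau>. w ! (3 * k)) + int \<tau>))"

type_synonym datum = "int list \<times> complex \<times> nat"

definition band_data :: "datum set" where
  "band_data = {(w, l, m). w \<in> words \<and> \<not> periodic w \<and> l \<noteq> 0 \<and> m \<ge> 1}"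

definition loop_data :: "datum set" where
  "loop_data = {(w', l', m'). w' \<in> words \<and> \<not> periodic w' \<and> normal w' \<and> l' \<noteq> 0 \<and> m' \<ge> 1}"

fun degenerate_band :: "datum \<Rightarrow> bool" where
  "degenerate_band (w, l, m) \<longleftrightarrow> w = [0, 0, 0] \<and> l = 1"

fun degenerate_loop :: "datum \<Rightarrow> bool" where
  "degenerate_loop (w', l', m') \<longleftrightarrow> w' = [2, 2, 2] \<and> l' = -1"

definition nondegenerate_band_data :: "datum set" where
  "nondegenerate_band_data = {x \<in> band_data. \<not> degenerate_band x}"

definition nondegenerate_loop_data :: "datum set" where
  "nondegenerate_loop_data = {x \<in> loop_data. \<not> degenerate_loop x}"

fun band_to_loop :: "datum \<Rightarrow> datum" where
  "band_to_loop (w, l, m) = (to_loop_word w, parameter_sign w * l, m)"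

text \<open>The sign is that of the resulting band word, not of the given loop word.\<close>

fun loop_to_band :: "datum \<Rightarrow> datum" where
  "loop_to_band (w', l', m') =
     (let w = to_band_word w' in (w, parameter_sign w * l', m'))"

end

theory Submission
  imports Defs
begin

text \<open>The sign word of a band word \<open>w\<close> can be read off from \<open>w + \<epsilon>(w)\<close>, since an entry of
  \<open>w + \<epsilon>(w)\<close> is positive exactly where \<open>\<delta>(w)\<close> is 1: hence \<open>w\<close> is recovered by subtracting the
  correction computed from \<open>\<delta>'\<close>. Conversely, for a normal word \<open>w'\<close> the signs
  \<open>\<delta>'(w')\<close> agree with \<open>\<delta>(w' - \<epsilon>'(w'))\<close>; the point is that positivity of \<open>w'\<close> is constant along
  every string of zeros of \<open>w' - \<epsilon>'(w')\<close>, and that a string of zeros on which \<open>w'\<close> is not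
  positive but whose two neighbours are positive would come from a forbidden subword
  \<open>(0,-1,\<dots>,-1,0)\<close>, \<open>(0,0)\<close> or \<open>(0)\<close> of \<open>w'\<close>. All constructions commute with cyclic shifts and
  thus preserve periodicity.\<close>

section \<open>Cyclic indexing\<close>

lemma fun_add_mult_period:
  fixes F :: "int \<Rightarrow> 'a"
  assumes "\<And>i. F (i + n) = F i"
  shows "F (i + k * n) = F i"
proof (induction k rule: int_induct[where k = 0])
  case (step1 k)
  then show ?case using assms[of "i + k * n"] by (simp add: algebra_simps)
next
  case (step2 k)
  then show ?case using assms[of "i + (k - 1) * n"] by (simp add: algebra_simps)
qed simp

lemma fun_mod_period:
  fixes F :: "int \<Rightarrow> 'a"
  assumes "\<And>i. F (i + n) = F i"
  shows "F (i mod n) = F i"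
  using fun_add_mult_period[of F n "i mod n" "i div n", OF assms] by (simp add: algebra_simps)

lemma cyc_add_length: "cyc w (i + int (length w)) = cyc w i"
  by (simp add: cyc_def)

lemma cyc_add_mult_length: "cyc w (i + k * int (length w)) = cyc w i"
  by (rule fun_add_mult_period) (rule cyc_add_length)

lemma nth_eq_cyc: "k < length w \<Longrightarrow> w ! k = cyc w (int k)"
  by (simp add: cyc_def)

lemma list_eq_cycI:
  assumes "length v = length w" "\<And>i. cyc v i = cyc w i"
  shows "v = w"
  using assms by (intro nth_equalityI) (simp_all add: nth_eq_cyc)

text \<open>Periodicity of \<open>F\<close> makes the table agree with \<open>F\<close> beyond
  \<open>[0..<n]\<close> as well, so words tabulated over one turn can be evaluated at every integer
  index.\<close>

lemma cyc_map_upt: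
  assumes "n > 0" "\<And>i. F (i + int n) = F i"
  shows "cyc (map (\<lambda>i. F (int i)) [0..<n]) i = F i"
proof -
  have "nat (i mod int n) < n"
    using assms(1) by (simp add: nat_less_iff)
  then have "cyc (map (\<lambda>i. F (int i)) [0..<n]) i = F (i mod int n)"
    using assms(1) by (simp add: cyc_def)
  then show ?thesis
    using fun_mod_period[of F "int n" i] assms(2) by simp
qed

lemma cyc_map:
  assumes "w \<noteq> []"
  shows "cyc (map h w) i = h (cyc w i)"
  using assms by (simp add: cyc_def nat_less_iff)

lemma cyc_map2:
  assumes "v \<noteq> []" "length v = length w"
  shows "cyc (map2 h v w) i = h (cyc v i) (cyc w i)"
proof -
  have "nat (i mod int (length w)) < length w"
    using assms by (simp add: nat_less_iff flip: length_greater_0_conv)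
  then show ?thesis
    using assms by (simp add: cyc_def)
qed

lemma words_iff: "w \<in> words \<longleftrightarrow> w \<noteq> [] \<and> 3 dvd length w"
proof -
  have "(\<exists>k\<ge>1. n = 3 * k) \<longleftrightarrow> n \<noteq> 0 \<and> 3 dvd n" for n :: nat
    by presburger
  then show ?thesis
    by (simp add: words_def)
qed

section \<open>The corrections entry by entry\<close>

lemma next_to_negative_shift:
  assumes "\<And>j. cyc v (j + n) = cyc w j" "next_to_negative w i"
  shows "next_to_negative v (i + n)"
proof -
  obtain a b where ab: "a < i" "i < b" "\<forall>m\<in>{a<..<b}. cyc w m = 0" "cyc w a \<noteq> 0" "cyc w b \<noteq> 0"
    "cyc w a < 0 \<or> cyc w b < 0"
    using assms(2) unfolding next_to_negative_def by blast
  have "\<forall>m\<in>{a + n<..<b + n}. cyc v m = 0"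
  proof
    fix m assume "m \<in> {a + n<..<b + n}"
    then have "cyc w (m - n) = 0"
      using ab(3) by auto
    then show "cyc v m = 0"
      using assms(1)[of "m - n"] by simp
  qed
  then show ?thesis
    unfolding next_to_negative_def using ab assms(1)
    by (intro exI[of _ "a + n"] exI[of _ "b + n"]) auto
qed

lemma next_to_negative_period:
  assumes "\<And>j. cyc w (j + n) = cyc w j"
  shows "next_to_negative w (i + n) \<longleftrightarrow> next_to_negative w i"
proof
  \<comment> \<open>A shift by \<open>- n\<close> carries witnesses back, which gives the
    converse.\<close>
  have "cyc w (j + - n) = cyc w j" for j
    using assms[of "j - n"] by simp
  from next_to_negative_shift[OF this, of "i + n"]
  show "next_to_negative w (i + n) \<Longrightarrow> next_to_negative w i"
    by simp
qed (rule next_to_negative_shift[OF assms])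

lemma length_sign_word [simp]: "length (sign_word w) = length w"
  and length_loop_sign_word [simp]: "length (loop_sign_word w) = length w"
  and length_correction_of_signs [simp]: "length (correction_of_signs w) = length w"
  and length_to_loop_word [simp]: "length (to_loop_word w) = length w"
  and length_to_band_word [simp]: "length (to_band_word w) = length w"
  by (simp_all add: sign_word_def loop_sign_word_def correction_of_signs_def
      to_loop_word_def to_band_word_def correction_def loop_correction_def)

lemma cyc_sign_word:
  assumes "w \<noteq> []"
  shows "cyc (sign_word w) i =
    (if cyc w i < 0 \<or> (cyc w i = 0 \<and> next_to_negative w i) then 0 else 1)"
  unfolding sign_word_def
  by (rule cyc_map_upt)
    (use assms in \<open>simp_all add: cyc_add_length next_to_negative_period\<close>)

lemma cyc_loop_sign_word:
  assumes "w \<noteq> []"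
  shows "cyc (loop_sign_word w) i = (if cyc w i \<le> 0 then 0 else 1)"
  using assms by (simp add: loop_sign_word_def cyc_map)

lemma cyc_correction_of_signs:
  assumes "d \<noteq> []"
  shows "cyc (correction_of_signs d) i = -1 + cyc d (i - 1) + cyc d i + cyc d (i + 1)"
  unfolding correction_of_signs_def
proof (rule cyc_map_upt)
  fix i
  show "- 1 + cyc d (i + int (length d) - 1) + cyc d (i + int (length d))
      + cyc d (i + int (length d) + 1) = - 1 + cyc d (i - 1) + cyc d i + cyc d (i + 1)"
    using cyc_add_length[of d "i - 1"] cyc_add_length[of d i] cyc_add_length[of d "i + 1"]
    by (simp add: algebra_simps)
qed (use assms in simp)

lemma cyc_to_loop_word:
  assumes "w \<noteq> []"
  shows "cyc (to_loop_word w) i =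
    cyc w i - 1 + cyc (sign_word w) (i - 1) + cyc (sign_word w) i + cyc (sign_word w) (i + 1)"
proof -
  have "sign_word w \<noteq> []"
    using assms by (simp add: sign_word_def)
  then show ?thesis
    using assms by (simp add: to_loop_word_def correction_def cyc_map2 cyc_correction_of_signs)
qed

lemma cyc_to_band_word:
  assumes "w \<noteq> []"
  shows "cyc (to_band_word w) i =
    cyc w i + 1 - cyc (loop_sign_word w) (i - 1) - cyc (loop_sign_word w) i
      - cyc (loop_sign_word w) (i + 1)"
proof -
  have "loop_sign_word w \<noteq> []"
    using assms by (simp add: loop_sign_word_def)
  then show ?thesis
    using assms by (simp add: to_band_word_def loop_correction_def cyc_map2 cyc_correction_of_signs)
qed

section \<open>Strings of zeros\<close>

lemma nonzero_right:
  assumes "w \<noteq> []" "cyc w k \<noteq> 0"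
  shows "\<exists>b>i. cyc w b \<noteq> 0 \<and> (\<forall>m\<in>{i<..<b}. cyc w m = 0)"
proof -
  let ?n = "int (length w)" and ?P = "\<lambda>t. cyc w (i + 1 + int t) \<noteq> 0"
  have n: "?n \<ge> 1"
    using assms(1) by (simp add: Suc_le_eq)
  \<comment> \<open>Moving \<open>k\<close> forward by \<open>\<bar>i + 1 - k\<bar>\<close> full
    turns takes it to \<open>i + 1\<close> or beyond; the least offset of a non-zero entry then
    exists.\<close>
  have "i + 1 - k \<le> \<bar>i + 1 - k\<bar> * ?n"
    using mult_left_mono[OF n abs_ge_zero[of "i + 1 - k"]] abs_ge_self[of "i + 1 - k"]
    unfolding mult_1_right by (rule order_trans[rotated])
  then have "k + \<bar>i + 1 - k\<bar> * ?n \<ge> i + 1"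
    by (simp only: diff_le_eq add.commute)
  then have "?P (nat (k + \<bar>i + 1 - k\<bar> * ?n - (i + 1)))"
    using assms(2) by (simp add: cyc_add_mult_length)
  then have P: "?P (Least ?P)"
    by (rule LeastI)
  define t where "t = Least ?P"
  have "cyc w m = 0" if "i < m" "m < i + 1 + int t" for m
  proof -
    have "nat (m - (i + 1)) < t"
      using that by linarith
    then show ?thesis
      using not_less_Least[of "nat (m - (i + 1))" ?P] that unfolding t_def by simp
  qed
  then show ?thesis
    using P unfolding t_def[symmetric] by (intro exI[of _ "i + 1 + int t"]) auto
qed

lemma nonzero_left:
  assumes "w \<noteq> []" "cyc w k \<noteq> 0"
  shows "\<exists>a<i. cyc w a \<noteq> 0 \<and> (\<forall>m\<in>{a<..<i}. cyc w m = 0)"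
proof -
  let ?n = "int (length w)" and ?P = "\<lambda>t. cyc w (i - 1 - int t) \<noteq> 0"
  have n: "?n \<ge> 1"
    using assms(1) by (simp add: Suc_le_eq)
  have "- (i - 1 - k) \<le> \<bar>i - 1 - k\<bar> * ?n"
    using mult_left_mono[OF n abs_ge_zero[of "i - 1 - k"]] abs_ge_minus_self[of "i - 1 - k"]
    unfolding mult_1_right by (rule order_trans[rotated])
  then have "k + - \<bar>i - 1 - k\<bar> * ?n \<le> i - 1"
    by (simp add: algebra_simps)
  then have "?P (nat (i - 1 - (k + - \<bar>i - 1 - k\<bar> * ?n)))"
    using assms(2) cyc_add_mult_length[of w k "- \<bar>i - 1 - k\<bar>"] by simp
  then have P: "?P (Least ?P)"
    by (rule LeastI)
  define t where "t = Least ?P"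
  have "cyc w m = 0" if "m < i" "i - 1 - int t < m" for m
  proof -
    have "nat (i - 1 - m) < t"
      using that by linarith
    then show ?thesis
      using not_less_Least[of "nat (i - 1 - m)" ?P] that unfolding t_def by simp
  qed
  then show ?thesis
    using P unfolding t_def[symmetric] by (intro exI[of _ "i - 1 - int t"]) auto
qed

lemma zero_string:
  assumes "w \<noteq> []" "cyc w k \<noteq> 0" "cyc w i = 0"
  obtains a b where "a < i" "i < b" "cyc w a \<noteq> 0" "cyc w b \<noteq> 0" "\<forall>m\<in>{a<..<b}. cyc w m = 0"
proof -
  obtain b where b: "b > i" "cyc w b \<noteq> 0" "\<forall>m\<in>{i<..<b}. cyc w m = 0"
    using nonzero_right[OF assms(1,2)] by blast
  obtain a where a: "a < i" "cyc w a \<noteq> 0" "\<forall>m\<in>{a<..<i}. cyc w m = 0"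
    using nonzero_left[OF assms(1,2)] by blast
  have "cyc w m = 0" if "m \<in> {a<..<b}" for m
    using that a(3) b(3) assms(3) by (cases m i rule: linorder_cases) auto
  then show ?thesis
    using a b that by blast
qed

text \<open>Adjacent zeros lie in the same maximal string, so the ends \<open>a\<close> and
  \<open>b\<close> found for one serve for the other.\<close>

lemma next_to_negative_adjacent:
  assumes "cyc w i = 0" "cyc w j = 0" "\<bar>i - j\<bar> \<le> 1" "next_to_negative w i"
  shows "next_to_negative w j"
proof -
  obtain a b where ab: "a < i" "i < b" "\<forall>m\<in>{a<..<b}. cyc w m = 0" "cyc w a \<noteq> 0" "cyc w b \<noteq> 0"
    "cyc w a < 0 \<or> cyc w b < 0"
    using assms(4) unfolding next_to_negative_def by blast
  moreover have "j \<noteq> a" "j \<noteq> b"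
    using ab(4,5) assms(2) by auto
  ultimately show ?thesis
    unfolding next_to_negative_def using assms(3) by (intro exI[of _ a] exI[of _ b]) auto
qed

text \<open>A negative entry adjacent to a zero cannot lie inside the string of that zero, so it is
  one of the two ends.\<close>

lemma next_to_negative_if_neighbour:
  assumes "w \<noteq> []" "cyc w i = 0" "cyc w j < 0" "\<bar>i - j\<bar> \<le> 1"
  shows "next_to_negative w i"
proof -
  obtain a b where ab: "a < i" "i < b" "cyc w a \<noteq> 0" "cyc w b \<noteq> 0" "\<forall>m\<in>{a<..<b}. cyc w m = 0"
    using zero_string[of w j i] assms by auto
  have "j \<notin> {a<..<b}"
    using ab(5) assms(3) by force
  then have "j = a \<or> j = b"
    using ab(1,2) assms(4) by auto
  then show ?thesis
    unfolding next_to_negative_def using ab assms(3) by (intro exI[of _ a] exI[of _ b]) auto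
qed

section \<open>From band words to loop words\<close>

lemma sign_word_01: "w \<noteq> [] \<Longrightarrow> cyc (sign_word w) i = 0 \<or> cyc (sign_word w) i = 1"
  by (simp add: cyc_sign_word)

lemma sign_word_1_nonneg: "w \<noteq> [] \<Longrightarrow> cyc (sign_word w) i = 1 \<Longrightarrow> cyc w i \<ge> 0"
  by (auto simp: cyc_sign_word split: if_splits)

lemma sign_word_0_nonpos: "w \<noteq> [] \<Longrightarrow> cyc (sign_word w) i = 0 \<Longrightarrow> cyc w i \<le> 0"
  by (auto simp: cyc_sign_word split: if_splits)

lemma sign_word_adjacent_zeros:
  assumes "w \<noteq> []" "cyc w i = 0" "cyc w j = 0" "\<bar>i - j\<bar> \<le> 1"
  shows "cyc (sign_word w) i = cyc (sign_word w) j"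
  using assms next_to_negative_adjacent[of w i j] next_to_negative_adjacent[of w j i]
  by (auto simp: cyc_sign_word)

text \<open>A zero of sign 1 has no negative neighbour; a neighbouring zero shares its string, and a
  positive neighbour has sign 1 anyway.\<close>

lemma sign_word_neighbour_of_positive_zero:
  assumes "w \<noteq> []" "cyc w i = 0" "cyc (sign_word w) i = 1" "\<bar>i - j\<bar> \<le> 1"
  shows "cyc (sign_word w) j = 1"
proof (cases "cyc w j" "0 :: int" rule: linorder_cases)
  case less
  then show ?thesis
    using next_to_negative_if_neighbour[of w i j] assms by (simp add: cyc_sign_word)
next
  case equal
  then show ?thesis
    using sign_word_adjacent_zeros[of w i j] assms by simp
next
  case greater
  then show ?thesis
    using assms(1) by (simp add: cyc_sign_word)
qed

text \<open>A neighbouring zero would share the sign 0, so a neighbour of sign 1 is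
  non-zero.\<close>

lemma sign_word_positive_neighbour:
  assumes "w \<noteq> []" "cyc w i = 0" "cyc (sign_word w) i = 0" "\<bar>i - j\<bar> \<le> 1"
    "cyc (sign_word w) j = 1"
  shows "cyc w j > 0"
  using sign_word_adjacent_zeros[of w i j] sign_word_1_nonneg[of w j] assms
  by (cases "cyc w j = 0") auto

text \<open>The non-zero ends of the string of zeros around \<open>i\<close> are unique, so
  witnesses \<open>c\<close> and \<open>d\<close> of a negative end would have to be
  \<open>a\<close> and \<open>b\<close>.\<close>

lemma sign_word_between_positive:
  assumes "w \<noteq> []" "a < i" "i < b" "\<forall>m\<in>{a<..<b}. cyc w m = 0" "cyc w a > 0" "cyc w b > 0"
  shows "cyc (sign_word w) i = 1"
proof -
  have "\<not> next_to_negative w i"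
  proof
    assume "next_to_negative w i"
    then obtain c d where cd: "c < i" "i < d" "\<forall>m\<in>{c<..<d}. cyc w m = 0"
      "cyc w c \<noteq> 0" "cyc w d \<noteq> 0" "cyc w c < 0 \<or> cyc w d < 0"
      unfolding next_to_negative_def by blast
    have "c = a"
    proof (cases c a rule: linorder_cases)
      case less
      then show ?thesis using cd(2,3) assms(2,5) by force
    next
      case greater
      then show ?thesis using cd(1,4) assms(3,4) by force
    qed
    moreover have "d = b"
    proof (cases d b rule: linorder_cases)
      case less
      then show ?thesis using cd(2,5) assms(2,4) by force
    next
      case greater
      then show ?thesis using cd(1,3) assms(3,6) by force
    qed
    ultimately show False
      using cd(6) assms(5,6) by auto
  qed
  then show ?thesis
    using assms by (simp add: cyc_sign_word)
qed

text \<open>With sign 0 at \<open>i\<close>, both neighbours would be strictly positive, and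
  \<open>i\<close> alone would be a string of zeros between positive ends, which has sign 1.\<close>

lemma sign_word_between_positive_signs:
  assumes "w \<noteq> []" "cyc w i = 0" "cyc (sign_word w) (i - 1) = 1" "cyc (sign_word w) (i + 1) = 1"
  shows "cyc (sign_word w) i = 1"
proof (rule ccontr)
  assume "cyc (sign_word w) i \<noteq> 1"
  then have i: "cyc (sign_word w) i = 0"
    using sign_word_01[of w i] assms(1) by auto
  then have "cyc w (i - 1) > 0" "cyc w (i + 1) > 0"
    using sign_word_positive_neighbour[of w i "i - 1"] sign_word_positive_neighbour[of w i "i + 1"]
      assms by auto
  moreover have "\<forall>m\<in>{i - 1<..<i + 1}. cyc w m = 0"
    by (metis assms(2) greaterThanLessThan_iff zle_add1_eq_le zle_diff1_eq order_antisym
        linorder_not_less)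
  ultimately show False
    using sign_word_between_positive[of w "i - 1" i "i + 1"] assms i by auto
qed

text \<open>For a non-zero entry the bounds -1 and 2 on the correction suffice, with its own sign
  taken into account. A zero of sign 1 has neighbours of sign 1 and becomes 2; a zero of sign 0 has
  at most one neighbour of sign 1 and becomes at most 0.\<close>

lemma to_loop_word_positive_iff:
  assumes "w \<noteq> []"
  shows "cyc (to_loop_word w) i > 0 \<longleftrightarrow> cyc (sign_word w) i = 1"
proof -
  note s = sign_word_01[OF assms, of i] sign_word_01[OF assms, of "i - 1"]
    sign_word_01[OF assms, of "i + 1"]
  show ?thesis
  proof (cases "cyc w i = 0")
    case True
    then show ?thesis
      using s sign_word_neighbour_of_positive_zero[OF assms True, of "i - 1"]
        sign_word_neighbour_of_positive_zero[OF assms True, of "i + 1"]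
        sign_word_between_positive_signs[OF assms True]
      by (auto simp: cyc_to_loop_word assms)
  next
    case False
    then show ?thesis
      using s sign_word_0_nonpos[OF assms, of i] sign_word_1_nonneg[OF assms, of i]
      by (auto simp: cyc_to_loop_word assms)
  qed
qed

lemma loop_sign_word_to_loop_word:
  assumes "w \<noteq> []"
  shows "loop_sign_word (to_loop_word w) = sign_word w"
proof (rule list_eq_cycI)
  fix i
  have "to_loop_word w \<noteq> []"
    using assms by (metis length_0_conv length_to_loop_word)
  then show "cyc (loop_sign_word (to_loop_word w)) i = cyc (sign_word w) i"
    using to_loop_word_positive_iff[OF assms, of i] sign_word_01[OF assms, of i]
    by (auto simp: cyc_loop_sign_word)
qed simp

text \<open>The correction subtracted is the one that was added, since both are computed from the
  same signs.\<close>

lemma to_band_word_to_loop_word: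
  assumes "w \<noteq> []"
  shows "to_band_word (to_loop_word w) = w"
proof (rule list_eq_cycI)
  fix i
  have "to_loop_word w \<noteq> []"
    using assms by (metis length_0_conv length_to_loop_word)
  then show "cyc (to_band_word (to_loop_word w)) i = cyc w i"
    by (simp add: cyc_to_band_word loop_sign_word_to_loop_word cyc_to_loop_word assms)
qed simp

section \<open>Normality of the loop word\<close>

lemma to_loop_word_eq_1:
  assumes "w \<noteq> []" "cyc (to_loop_word w) i = 1" "\<bar>i - j\<bar> = 1"
  shows "cyc (sign_word w) j = 0"
proof -
  have i: "cyc (sign_word w) i = 1"
    using to_loop_word_positive_iff[OF assms(1), of i] assms(2) by simp
  \<comment> \<open>A zero of sign 1 would yield the value 2. So the entry of \<open>w\<close> is at
    least 1, and the value 1 leaves no room for a neighbouring sign 1.\<close>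
  show ?thesis
  proof (cases "cyc w i = 0")
    case True
    then show ?thesis
      using sign_word_neighbour_of_positive_zero[OF assms(1) True i, of "i - 1"] i
        sign_word_neighbour_of_positive_zero[OF assms(1) True i, of "i + 1"] assms(2)
      by (simp add: cyc_to_loop_word assms(1))
  next
    case False
    have "j = i - 1 \<or> j = i + 1"
      using assms(3) by linarith
    then show ?thesis
      using False i sign_word_1_nonneg[OF assms(1) i] assms(2) sign_word_01[OF assms(1), of "i - 1"]
        sign_word_01[OF assms(1), of "i + 1"]
      by (auto simp: cyc_to_loop_word assms(1))
  qed
qed

text \<open>The distance-one indices \<open>j\<close> and \<open>k\<close> stand for \<open>i - 1\<close> and \<open>i + 1\<close> in either order.\<close>

lemma to_loop_word_eq_0:
  assumes "w \<noteq> []" "cyc (to_loop_word w) i = 0" "\<bar>i - j\<bar> = 1" "k = 2 * i - j"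
    "cyc (sign_word w) k = 0"
  shows "cyc w i = 0" "cyc w j > 0" "cyc (to_loop_word w) k \<le> -1"
proof -
  have i: "cyc (sign_word w) i = 0"
    using to_loop_word_positive_iff[OF assms(1), of i] sign_word_01[OF assms(1), of i] assms(2)
    by auto
  have jk: "j = i - 1 \<and> k = i + 1 \<or> j = i + 1 \<and> k = i - 1"
    using assms(3,4) by linarith
  \<comment> \<open>The signs at \<open>i\<close> and \<open>k\<close> are 0, so only the sign at
    \<open>j\<close> remains; as the entry of \<open>w\<close> at \<open>i\<close> is at most 0, it
    must be 0 and the sign at \<open>j\<close> must be 1.\<close>
  have g: "cyc w i - 1 + cyc (sign_word w) j = 0"
    using jk assms(2,5) i by (auto simp: cyc_to_loop_word assms(1))
  then show w0: "cyc w i = 0"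
    using sign_word_01[OF assms(1), of j] sign_word_0_nonpos[OF assms(1) i] by auto
  with g have j: "cyc (sign_word w) j = 1"
    by simp
  then show wj: "cyc w j > 0"
    using sign_word_positive_neighbour[OF assms(1) w0 i, of j] assms(3) by simp
  \<comment> \<open>The neighbour of \<open>k\<close> other than \<open>i\<close>.\<close>
  define l where "l = 2 * k - i"
  have "cyc (to_loop_word w) k = cyc w k - 1 + cyc (sign_word w) l"
    using jk i assms(5) unfolding l_def by (auto simp: cyc_to_loop_word assms(1) algebra_simps)
  moreover have "cyc w k \<le> 0"
    using sign_word_0_nonpos[OF assms(1,5)] .
  \<comment> \<open>Otherwise \<open>i\<close> and \<open>k\<close> would form a string of zeros
    between the positive entries at \<open>j\<close> and \<open>l\<close>, so \<open>i\<close> would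
    have sign 1.\<close>
  moreover have "cyc (sign_word w) l = 0" if "cyc w k = 0"
  proof (rule ccontr)
    assume "cyc (sign_word w) l \<noteq> 0"
    then have l: "cyc (sign_word w) l = 1"
      using sign_word_01[OF assms(1), of l] by auto
    have "\<bar>k - l\<bar> \<le> 1"
      using jk unfolding l_def by auto
    then have wl: "cyc w l > 0"
      using sign_word_positive_neighbour[OF assms(1) that assms(5) _ l] by simp
    have "cyc (sign_word w) i = 1"
    proof (cases "j < i")
      case True
      with jk have "j = i - 1" "k = i + 1" "l = i + 2"
        unfolding l_def by auto
      moreover have "{j<..<l} = {i, k}"
        using calculation by auto
      ultimately show ?thesis
        using sign_word_between_positive[of w j i l] assms(1) w0 wj wl \<open>cyc w k = 0\<close> by simp
    next
      case False
      with jk have "j = i + 1" "k = i - 1" "l = i - 2"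
        unfolding l_def by auto
      moreover have "{l<..<j} = {i, k}"
        using calculation by auto
      ultimately show ?thesis
        using sign_word_between_positive[of w l i j] assms(1) w0 wj wl \<open>cyc w k = 0\<close> by simp
    qed
    with i show False by simp
  qed
  ultimately show "cyc (to_loop_word w) k \<le> -1"
    using sign_word_01[OF assms(1), of l] by (cases "cyc w k = 0") auto
qed

lemma normal_to_loop_word:
  assumes "w \<noteq> []"
  shows "normal (to_loop_word w)"
proof -
  let ?f = "cyc w" and ?d = "cyc (sign_word w)" and ?g = "cyc (to_loop_word w)"
  note pos = to_loop_word_positive_iff[OF assms]
  note d01 = sign_word_01[OF assms]
  have nonpos: "?d i = 0 \<longleftrightarrow> ?g i \<le> 0" for i
    using pos[of i] d01[of i] by auto
  \<comment> \<open>With all three signs 0 the correction is -1, which accounts for the whole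
    entry.\<close>
  have middle: "?f i = 0" if "?g i = -1" "?d (i - 1) = 0" "?d (i + 1) = 0" for i
    using that nonpos[of i] by (simp add: cyc_to_loop_word assms)
  have 1: "?g (i - 1) \<le> 0 \<and> ?g (i + 1) \<le> 0" if "?g i = 1" for i
    using to_loop_word_eq_1[OF assms that, of "i - 1"] to_loop_word_eq_1[OF assms that, of "i + 1"]
    by (simp add: nonpos)
  have 2: "(?g (i - 1) \<le> -1 \<and> ?g (i + 1) \<ge> 1) \<or> (?g (i - 1) \<ge> 1 \<and> ?g (i + 1) \<le> -1) \<or>
      (?g (i - 1) \<ge> 1 \<and> ?g (i + 1) \<ge> 1)" if "?g i = 0" for i
  proof -
    have "?g (i + 1) \<le> -1" if "?g (i + 1) \<le> 0"
      using to_loop_word_eq_0(3)[OF assms \<open>?g i = 0\<close>, of "i - 1" "i + 1"] nonpos that by simp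
    moreover have "?g (i - 1) \<le> -1" if "?g (i - 1) \<le> 0"
      using to_loop_word_eq_0(3)[OF assms \<open>?g i = 0\<close>, of "i + 1" "i - 1"] nonpos that by simp
    \<comment> \<open>Two non-positive neighbours are excluded here; the bounds above take care of
      the rest.\<close>
    moreover have "?g (i - 1) \<ge> 1" if "?g (i + 1) \<le> 0"
    proof -
      have "?f (i - 1) > 0"
        using to_loop_word_eq_0(2)[OF assms \<open>?g i = 0\<close>, of "i - 1" "i + 1"] nonpos that by simp
      then have "?d (i - 1) = 1"
        by (simp add: cyc_sign_word assms)
      then show ?thesis
        using pos[of "i - 1"] by simp
    qed
    ultimately show ?thesis
      by linarith
  qed
  have 3: False if ab: "a + 1 < b" "?g a = 0" "?g b = 0" "\<forall>m\<in>{a<..<b}. ?g m = -1" for a b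
  proof -
    \<comment> \<open>The signs from \<open>a\<close> to \<open>b\<close> are 0, so \<open>w\<close>
      vanishes on the whole stretch. The zeros at its two ends force \<open>w\<close> to be positive
      at \<open>a - 1\<close> and \<open>b + 1\<close>, and then the signs on the stretch would be
      1.\<close>
    have d0: "?d m = 0" if "a \<le> m" "m \<le> b" for m
      using that ab(2-4) nonpos[of m] by (cases "m = a"; cases "m = b") auto
    have a: "?f a = 0" "?f (a - 1) > 0"
      using to_loop_word_eq_0[OF assms ab(2), of "a - 1" "a + 1"] d0[of "a + 1"] ab(1) by simp_all
    have b: "?f b = 0" "?f (b + 1) > 0"
      using to_loop_word_eq_0[OF assms ab(3), of "b + 1" "b - 1"] d0[of "b - 1"] ab(1) by simp_all
    have "?f m = 0" if "m \<in> {a - 1<..<b + 1}" for m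
    proof (cases "m = a \<or> m = b")
      case False
      with that have "a < m" "m < b"
        by auto
      then show ?thesis
        using middle[of m] d0[of "m - 1"] d0[of "m + 1"] ab(4) by simp
    qed (use a b in auto)
    then have "?d a = 1"
      using sign_word_between_positive[of w "a - 1" a "b + 1"] a b ab(1) assms by simp
    then show False
      using d0[of a] ab(1) by simp
  qed
  have 4: False if "to_loop_word w = replicate (length (to_loop_word w)) (-1)"
  proof -
    \<comment> \<open>Such a loop word would come from the zero word with all signs 0, but a zero of
      sign 0 needs a non-zero entry at the end of its string.\<close>
    have "?g i = -1" for i
      by (subst that) (use assms in \<open>simp add: cyc_def nat_less_iff\<close>)
    then have d: "?d i = 0" "?f i = 0" for i
      using nonpos middle by simp_all
    then have "next_to_negative w 0"
      using cyc_sign_word[OF assms, of 0] by (simp split: if_splits)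
    then show False
      using d(2) by (auto simp: next_to_negative_def)
  qed
  show ?thesis
    unfolding normal_def using 1 2 3 4 by blast
qed

section \<open>From loop words to band words\<close>

text \<open>At a positive entry of \<open>w\<close> the band entry is that entry minus the number of
  positive neighbours. An entry 1 has none by (i); so the result is never negative, and it is 0 only
  for an entry 2 with both neighbours positive.\<close>

lemma pos_along_zero_string:
  assumes "w \<noteq> []" "normal w" "cyc w i > 0"
  shows "cyc (to_band_word w) i \<ge> 0"
    and "\<lbrakk>cyc (to_band_word w) i = 0; \<bar>i - j\<bar> \<le> 1\<rbrakk> \<Longrightarrow> cyc w j > 0"
proof -
  have n: "cyc w i = 1 \<Longrightarrow> cyc w (i - 1) \<le> 0 \<and> cyc w (i + 1) \<le> 0"
    using assms(2) unfolding normal_def by blast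
  show "cyc (to_band_word w) i \<ge> 0"
    using n assms(3) by (cases "cyc w i = 1") (auto simp: cyc_to_band_word cyc_loop_sign_word assms(1))
  assume b: "cyc (to_band_word w) i = 0" "\<bar>i - j\<bar> \<le> 1"
  have "cyc w i \<noteq> 1"
    using n b(1) by (auto simp: cyc_to_band_word cyc_loop_sign_word assms(1))
  then have "cyc w (i - 1) > 0 \<and> cyc w (i + 1) > 0"
    using b(1) assms(3)
    by (simp add: cyc_to_band_word cyc_loop_sign_word assms(1) split: if_splits)
  moreover have "j = i - 1 \<or> j = i \<or> j = i + 1"
    using b(2) by linarith
  ultimately show "cyc w j > 0"
    using assms(3) by auto
qed

text \<open>Positivity spreads from \<open>i\<close> step by step in both directions. The ends
  \<open>a\<close> and \<open>b\<close> are reached too, being neighbours of zeros of the band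
  word.\<close>

lemma pos_on_zero_string:
  assumes "w \<noteq> []" "normal w" "\<forall>m\<in>{a<..<b}. cyc (to_band_word w) m = 0"
    and "i \<in> {a<..<b}" "cyc w i > 0" "j \<in> {a..b}"
  shows "cyc w j > 0"
proof -
  have "k \<le> b \<longrightarrow> cyc w k > 0" if "i \<le> k" for k
    using that
  proof (induction k rule: int_ge_induct)
    case (step k)
    then show ?case
      using pos_along_zero_string(2)[OF assms(1,2), of k "k + 1"] assms(3,4) by auto
  qed (use assms in simp)
  moreover have "a \<le> k \<longrightarrow> cyc w k > 0" if "k \<le> i" for k
    using that
  proof (induction k rule: int_le_induct)
    case (step k)
    then show ?case
      using pos_along_zero_string(2)[OF assms(1,2), of k "k - 1"] assms(3,4) by auto
  qed (use assms in simp)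
  ultimately show ?thesis
    using assms(6) by (cases "i \<le> j") auto
qed

text \<open>An entry 0 of \<open>w\<close> has a positive neighbour by (ii), which cancels the added
  1; a negative entry absorbs it.\<close>

lemma to_band_word_nonpos:
  assumes "w \<noteq> []" "normal w" "cyc w i \<le> 0"
  shows "cyc (to_band_word w) i \<le> 0"
proof -
  have "cyc w i = 0 \<Longrightarrow> cyc w (i - 1) \<ge> 1 \<or> cyc w (i + 1) \<ge> 1"
    using assms(2) unfolding normal_def by blast
  then show ?thesis
    using assms(3) by (cases "cyc w i = 0") (auto simp: cyc_to_band_word cyc_loop_sign_word assms(1))
qed

text \<open>If the band word were zero, one positive entry of \<open>w\<close> would make all
  entries positive. So all signs would be 0 and all entries -1, against (iv).\<close>

lemma to_band_word_nonzero:
  assumes "w \<noteq> []" "normal w" "cyc w i \<le> 0"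
  shows "\<exists>k. cyc (to_band_word w) k \<noteq> 0"
proof (rule ccontr)
  assume "\<not> ?thesis"
  then have z: "cyc (to_band_word w) k = 0" for k
    by blast
  have np: "cyc w k \<le> 0" for k
  proof (rule ccontr)
    assume "\<not> cyc w k \<le> 0"
    \<comment> \<open>The window is chosen to contain both \<open>i\<close> and \<open>k\<close> in
      its interior.\<close>
    then have "cyc w i > 0"
      using pos_on_zero_string[OF assms(1,2), of "min i k - 1" "max i k + 1" k i] z
      by (auto simp: min_def max_def)
    with assms(3) show False
      by simp
  qed
  have "cyc w k = -1" for k
    using z[of k] np[of k] np[of "k - 1"] np[of "k + 1"]
    by (simp add: cyc_to_band_word cyc_loop_sign_word assms(1))
  then have "w = replicate (length w) (-1)"
    by (intro nth_equalityI) (simp_all add: nth_eq_cyc[of _ w])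
  then show False
    using assms(2) unfolding normal_def by blast
qed

text \<open>On such a string each entry of \<open>w\<close> is the number of its positive neighbours
  minus 1. A string of length one would thus have the positive entry 1; a longer one reads 0, -1,
  ..., -1, 0.\<close>

lemma no_nonpos_string_between_positive:
  assumes "w \<noteq> []" "normal w" "\<forall>m\<in>{a<..<b}. cyc (to_band_word w) m = 0 \<and> cyc w m \<le> 0"
    and "a + 1 < b" "cyc w a > 0" "cyc w b > 0"
  shows False
proof -
  let ?f = "cyc (to_band_word w)" and ?g = "cyc w"
  have f: "?f i = ?g i + 1 - (if ?g (i - 1) > 0 then 1 else 0) - (if ?g i > 0 then 1 else 0)
      - (if ?g (i + 1) > 0 then 1 else 0)" for i
    by (simp add: cyc_to_band_word cyc_loop_sign_word assms(1))
  show False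
  proof (cases "a + 2 = b")
    case True
    then show False
      using f[of "a + 1"] bspec[OF assms(3), of "a + 1"] assms(5,6) by (simp add: add.assoc)
  next
    case False
    with assms(4) have ab: "a + 2 < b"
      by simp
    have ga: "?g (a + 1) = 0"
      using f[of "a + 1"] bspec[OF assms(3), of "a + 1"] bspec[OF assms(3), of "a + 2"] assms(5) ab
      by (simp add: add.assoc)
    have gb: "?g (b - 1) = 0"
      using f[of "b - 1"] bspec[OF assms(3), of "b - 1"] bspec[OF assms(3), of "b - 2"] assms(6) ab
      by simp
    have gm: "?g m = -1" if "m \<in> {a + 1<..<b - 1}" for m
      using f[of m] bspec[OF assms(3), of m] bspec[OF assms(3), of "m - 1"]
        bspec[OF assms(3), of "m + 1"] that by auto
    \<comment> \<open>Length two gives adjacent zeros, excluded by (ii); longer strings are excluded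
      by (iii).\<close>
    show False
    proof (cases "a + 3 = b")
      case True
      then have "?g (a + 1 + 1) = 0"
        using gb by (simp add: add.commute flip: True)
      moreover have "?g (a + 1 + 1) \<noteq> 0"
        using assms(2) ga unfolding normal_def by fastforce
      ultimately show False by simp
    next
      case False
      with ab have "a + 1 + 1 < b - 1"
        by simp
      then show False
        using assms(2) ga gb gm unfolding normal_def by blast
    qed
  qed
qed

lemma sign_word_to_band_word:
  assumes "w \<noteq> []" "normal w"
  shows "sign_word (to_band_word w) = loop_sign_word w"
proof (rule list_eq_cycI)
  fix i
  let ?v = "to_band_word w"
  have v: "?v \<noteq> []"
    using assms(1) by (metis length_0_conv length_to_band_word)
  show "cyc (sign_word ?v) i = cyc (loop_sign_word w) i"
  proof (cases "cyc w i > 0")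
    case True
    have "\<not> next_to_negative ?v i"
    proof
      assume "next_to_negative ?v i"
      then obtain a b where ab: "a < i" "i < b" "\<forall>m\<in>{a<..<b}. cyc ?v m = 0"
        "cyc ?v a < 0 \<or> cyc ?v b < 0"
        unfolding next_to_negative_def by blast
      \<comment> \<open>Positivity spreads from \<open>i\<close> to both ends of the string, where
        the band entries are then not negative.\<close>
      then have "cyc w a > 0" "cyc w b > 0"
        using pos_on_zero_string[OF assms ab(3), of i] True by auto
      then show False
        using pos_along_zero_string(1)[OF assms] ab(4) by (metis not_less)
    qed
    then show ?thesis
      using True pos_along_zero_string(1)[OF assms True]
      by (simp add: cyc_sign_word cyc_loop_sign_word v assms(1))
  next
    case False
    then have i: "cyc w i \<le> 0"
      by simp
    have "next_to_negative ?v i" if zi: "cyc ?v i = 0"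
    proof -
      obtain a b where ab: "a < i" "i < b" "cyc ?v a \<noteq> 0" "cyc ?v b \<noteq> 0"
        "\<forall>m\<in>{a<..<b}. cyc ?v m = 0"
        using to_band_word_nonzero[OF assms i] zero_string[OF v _ zi] by metis
      \<comment> \<open>A positive entry of \<open>w\<close> inside the string would spread to
        \<open>i\<close>.\<close>
      have np: "\<forall>m\<in>{a<..<b}. cyc ?v m = 0 \<and> cyc w m \<le> 0"
        using pos_on_zero_string[OF assms ab(5), of _ i] ab i by force
      have "cyc ?v a < 0 \<or> cyc ?v b < 0"
      proof (rule ccontr)
        assume "\<not> ?thesis"
        then have "cyc ?v a > 0" "cyc ?v b > 0"
          using ab by auto
        then have "cyc w a > 0" "cyc w b > 0"
          using to_band_word_nonpos[OF assms] by (meson not_less)+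
        then show False
          using no_nonpos_string_between_positive[OF assms np] ab(1,2) by simp
      qed
      then show ?thesis
        unfolding next_to_negative_def using ab by blast
    qed
    then show ?thesis
      using i to_band_word_nonpos[OF assms i]
      by (auto simp: cyc_sign_word cyc_loop_sign_word v assms(1))
  qed
qed simp

lemma to_loop_word_to_band_word:
  assumes "w \<noteq> []" "normal w"
  shows "to_loop_word (to_band_word w) = w"
proof (rule list_eq_cycI)
  fix i
  have "to_band_word w \<noteq> []"
    using assms(1) by (metis length_0_conv length_to_band_word)
  then show "cyc (to_loop_word (to_band_word w)) i = cyc w i"
    by (simp add: cyc_to_band_word sign_word_to_band_word cyc_to_loop_word assms)
qed simp

section \<open>Periodicity and parameters\<close>

text \<open>Shift invariance of \<open>cyc w\<close> passes entry by entry through both word maps,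
  which is not visible on a concatenation of lists.\<close>

lemma periodic_iff:
  assumes "w \<in> words"
  shows "periodic w \<longleftrightarrow> (\<exists>p N. p > 0 \<and> 3 dvd p \<and> N \<ge> 2 \<and> length w = N * p \<and>
    (\<forall>i. cyc w (i + int p) = cyc w i))" (is "_ \<longleftrightarrow> ?R")
proof
  have len: "length (concat (replicate N u)) = N * length u" for N and u :: "int list"
    by (induction N) auto
  have nth: "concat (replicate N u) ! k = u ! (k mod length u)" if "k < N * length u"
    for N k and u :: "int list"
    using that
  proof (induction N arbitrary: k)
    case (Suc N)
    then show ?case
      by (auto simp: nth_append le_mod_geq)
  qed simp
  {
    assume "periodic w"
    then obtain N u where u: "N \<ge> 2" "u \<in> words" "w = concat (replicate N u)"
      unfolding periodic_def by blast
    have lw: "length w = N * length u" and u0: "u \<noteq> []"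
      using u len by (auto simp: words_iff)
    have "cyc w i = cyc u i" for i
    proof -
      have "nat (i mod int (length w)) < N * length u"
        using u0 u(1) lw by (simp add: nat_less_iff)
      then have "cyc w i = u ! (nat (i mod int (length w)) mod length u)"
        unfolding cyc_def u(3) by (subst nth) (simp_all add: len)
      also have "nat (i mod int (length w)) mod length u = nat (i mod int (length w) mod int (length u))"
        using u0 u(1) lw by (simp add: nat_mod_distrib)
      \<comment> \<open>The length of \<open>u\<close> divides that of \<open>w\<close>, so the
        outer reduction absorbs the inner one.\<close>
      also have "\<dots> = nat (i mod int (length u))"
        by (simp add: lw mod_mod_cancel)
      finally show ?thesis
        by (simp add: cyc_def)
    qed
    then have "\<forall>i. cyc w (i + int (length u)) = cyc w i"
      by (simp add: cyc_add_length)
    then show ?R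
      using u lw by (intro exI[of _ "length u"] exI[of _ N]) (auto simp: words_iff)
  }
  assume ?R
  then obtain p N where p: "p > 0" "3 dvd p" "N \<ge> 2" "length w = N * p"
    "\<And>i. cyc w (i + int p) = cyc w i"
    by blast
  let ?u = "take p w"
  have pw: "p \<le> length w"
    using p by simp
  then have lu: "length ?u = p"
    by simp
  have "w = concat (replicate N ?u)"
  proof (rule nth_equalityI)
    fix k assume k: "k < length w"
    have "k mod p < p"
      using p(1) by simp
    then have "?u ! (k mod p) = cyc w (int (k mod p))"
      using pw nth_eq_cyc[of "k mod p" w] by (simp del: mod_less_divisor)
    also have "\<dots> = cyc w (int k)"
      using fun_mod_period[of "cyc w" "int p" "int k", OF p(5)] by (simp add: of_nat_mod)
    also have "\<dots> = w ! k"
      using k by (simp add: nth_eq_cyc)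
    finally show "w ! k = concat (replicate N ?u) ! k"
      using nth[of k N ?u] k p(4) lu by simp
  qed (simp only: len lu p(4))
  moreover have "?u \<in> words"
    using p lu by (auto simp: words_iff)
  ultimately show "periodic w"
    unfolding periodic_def using p(3) by blast
qed

lemma to_loop_word_period:
  assumes "w \<noteq> []" "\<And>i. cyc w (i + p) = cyc w i"
  shows "cyc (to_loop_word w) (i + p) = cyc (to_loop_word w) i"
proof -
  have "cyc (sign_word w) (i + p) = cyc (sign_word w) i" for i
    using assms by (simp add: cyc_sign_word next_to_negative_period)
  from this[of i] this[of "i - 1"] this[of "i + 1"] show ?thesis
    using assms by (simp add: cyc_to_loop_word algebra_simps)
qed

lemma to_band_word_period:
  assumes "w \<noteq> []" "\<And>i. cyc w (i + p) = cyc w i"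
  shows "cyc (to_band_word w) (i + p) = cyc (to_band_word w) i"
proof -
  have "cyc (loop_sign_word w) (i + p) = cyc (loop_sign_word w) i" for i
    using assms by (simp add: cyc_loop_sign_word)
  from this[of i] this[of "i - 1"] this[of "i + 1"] show ?thesis
    using assms by (simp add: cyc_to_band_word algebra_simps)
qed

lemma to_loop_word_words: "w \<in> words \<Longrightarrow> to_loop_word w \<in> words"
  and to_band_word_words: "w \<in> words \<Longrightarrow> to_band_word w \<in> words"
  by (simp_all add: words_def)

text \<open>Together with its counterpart for \<open>to_band_word\<close> this transports
  non-periodicity: a periodic image would be sent back to a periodic word.\<close>

lemma periodic_to_loop_word:
  assumes "w \<in> words" "periodic w"
  shows "periodic (to_loop_word w)"
proof -
  obtain p N where p: "p > 0" "3 dvd p" "N \<ge> 2" "length w = N * p"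
    "\<And>i. cyc w (i + int p) = cyc w i"
    using assms periodic_iff by blast
  have "w \<noteq> []"
    using assms(1) by (simp add: words_iff)
  from to_loop_word_period[OF this p(5)] show ?thesis
    unfolding periodic_iff[OF to_loop_word_words[OF assms(1)]]
    using p(1-4) by (intro exI[of _ p] exI[of _ N]) simp
qed

lemma periodic_to_band_word:
  assumes "w \<in> words" "periodic w"
  shows "periodic (to_band_word w)"
proof -
  obtain p N where p: "p > 0" "3 dvd p" "N \<ge> 2" "length w = N * p"
    "\<And>i. cyc w (i + int p) = cyc w i"
    using assms periodic_iff by blast
  have "w \<noteq> []"
    using assms(1) by (simp add: words_iff)
  from to_band_word_period[OF this p(5)] show ?thesis
    unfolding periodic_iff[OF to_band_word_words[OF assms(1)]]
    using p(1-4) by (intro exI[of _ p] exI[of _ N]) simp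
qed

section \<open>Parameter signs and the degenerate data\<close>

lemma parameter_sign_square: "parameter_sign w * (parameter_sign w * l) = l"
proof -
  have "((-1) powi k) * ((-1) powi k) = (1 :: complex)" for k :: int
    by (simp flip: power_int_mult_distrib)
  then show ?thesis
    by (simp add: parameter_sign_def Let_def flip: mult.assoc)
qed

lemma parameter_sign_nonzero: "parameter_sign w \<noteq> 0"
  by (simp add: parameter_sign_def Let_def)

text \<open>Here \<tau> = 1 and the sum is 0. This sign matches the degenerate parameter 1 of band
  data with the degenerate parameter -1 of loop data.\<close>

lemma parameter_sign_000: "parameter_sign [0, 0, 0] = -1"
  by (simp add: parameter_sign_def)

lemma to_band_word_222: "to_band_word [2, 2, 2] = [0, 0, 0]"
  by (simp add: to_band_word_def loop_correction_def loop_sign_word_def correction_of_signs_def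
      cyc_def upt_rec numeral_eq_Suc)

lemma normal_222: "normal [2, 2, 2]"
proof -
  have "cyc [2, 2, 2] i = 2" for i
  proof -
    have "i mod 3 = 0 \<or> i mod 3 = 1 \<or> i mod 3 = 2"
      by presburger
    then show ?thesis
      by (auto simp: cyc_def)
  qed
  then show ?thesis
    by (simp add: normal_def)
qed

text \<open>Obtained through the inverse map, which evaluates directly on a concrete list, whereas
  \<open>next_to_negative\<close> quantifies over all integer positions.\<close>

lemma to_loop_word_000: "to_loop_word [0, 0, 0] = [2, 2, 2]"
  using to_loop_word_to_band_word[OF _ normal_222] by (simp add: to_band_word_222)

section \<open>The mutually inverse maps on non-degenerate data\<close>

lemma band_to_loop_nondegenerate:
  assumes "x \<in> nondegenerate_band_data"
  shows "band_to_loop x \<in> nondegenerate_loop_data" "loop_to_band (band_to_loop x) = x"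
proof -
  obtain w l m where x: "x = (w, l, m)"
    by (cases x)
  with assms have w: "w \<in> words" "\<not> periodic w" "l \<noteq> 0" "m \<ge> 1" "\<not> (w = [0, 0, 0] \<and> l = 1)"
    by (auto simp: nondegenerate_band_data_def band_data_def)
  then have "w \<noteq> []"
    by (simp add: words_iff)
  note inv = to_band_word_to_loop_word[OF this] and norm = normal_to_loop_word[OF this]
  have "\<not> periodic (to_loop_word w)"
    using periodic_to_band_word[OF to_loop_word_words[OF w(1)]] w(2) inv by auto
  \<comment> \<open>A degenerate image forces \<open>w = [0, 0, 0]\<close>, whose sign is -1, and
    hence \<open>l = 1\<close>, the excluded datum.\<close>
  moreover have "\<not> (to_loop_word w = [2, 2, 2] \<and> parameter_sign w * l = -1)"
    using inv w(5) by (auto simp: to_band_word_222 parameter_sign_000)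
  ultimately show "band_to_loop x \<in> nondegenerate_loop_data"
    using w norm by (simp add: x nondegenerate_loop_data_def loop_data_def to_loop_word_words
        parameter_sign_nonzero)
  \<comment> \<open>Both maps use the sign of the same band word \<open>w\<close>, and this sign
    squares to 1.\<close>
  show "loop_to_band (band_to_loop x) = x"
    by (simp add: x inv parameter_sign_square)
qed

lemma loop_to_band_nondegenerate:
  assumes "y \<in> nondegenerate_loop_data"
  shows "loop_to_band y \<in> nondegenerate_band_data" "band_to_loop (loop_to_band y) = y"
proof -
  obtain w l m where y: "y = (w, l, m)"
    by (cases y)
  with assms have w: "w \<in> words" "\<not> periodic w" "normal w" "l \<noteq> 0" "m \<ge> 1"
    "\<not> (w = [2, 2, 2] \<and> l = -1)"
    by (auto simp: nondegenerate_loop_data_def loop_data_def)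
  then have "w \<noteq> []"
    by (simp add: words_iff)
  note inv = to_loop_word_to_band_word[OF this w(3)]
  have "\<not> periodic (to_band_word w)"
    using periodic_to_loop_word[OF to_band_word_words[OF w(1)]] w(2) inv by auto
  moreover have "\<not> (to_band_word w = [0, 0, 0] \<and> parameter_sign (to_band_word w) * l = 1)"
  proof
    assume *: "to_band_word w = [0, 0, 0] \<and> parameter_sign (to_band_word w) * l = 1"
    then have "w = [2, 2, 2]"
      using inv by (simp add: to_loop_word_000)
    moreover have "l = -1"
      using * by (metis parameter_sign_000 mult_minus1 minus_minus)
    ultimately show False
      using w(6) by simp
  qed
  ultimately show "loop_to_band y \<in> nondegenerate_band_data"
    using w by (simp add: y nondegenerate_band_data_def band_data_def to_band_word_words
        parameter_sign_nonzero Let_def)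
  show "band_to_loop (loop_to_band y) = y"
    by (simp add: y inv parameter_sign_square Let_def)
qed

theorem theorem1p9:
  shows "(\<forall>w\<in>words. to_loop_word w \<in> words \<and> normal (to_loop_word w)) \<and>
    bij_betw band_to_loop nondegenerate_band_data nondegenerate_loop_data \<and>
    (\<forall>x\<in>nondegenerate_band_data. loop_to_band (band_to_loop x) = x) \<and>
    (\<forall>y\<in>nondegenerate_loop_data. loop_to_band y \<in> nondegenerate_band_data \<and>
       band_to_loop (loop_to_band y) = y)"
proof -
  have "bij_betw band_to_loop nondegenerate_band_data nondegenerate_loop_data"
    by (rule bij_betw_byWitness[where f' = loop_to_band])
      (use band_to_loop_nondegenerate loop_to_band_nondegenerate in blast)+
  then show ?thesis
    using to_loop_word_words normal_to_loop_word band_to_loop_nondegenerate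
      loop_to_band_nondegenerate words_iff by blast
qed

end
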